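(* The following two assertions are equivalent. (i) (Vizing's conjecture) For all graphs $G$ and $H$, $\gamma(G)\,\gamma(H)\le \gamma(G\Box H)$. (ii) For all positive integers $n_{\mathcal G},k_{\mathcal G},n_{\mathcal H},k_{\mathcal H}$ with $k_{\mathcal G}\le n_{\mathcal G}$ and $k_{\mathcal H}\le n_{\mathcal H}$, the polynomial $$f^{*}=\Bigl(\sum_{(g,h)\in V(\mathcal G)\times V(\mathcal H)}x_{gh}\Bigr)-k_{\mathcal G}k_{\mathcal H}$$ is nonnegative on the variety of $I_{\mathrm{sos}}$, i.e. $f^{*}(z)\ge 0$ for all $z\in\mathcal V(I_{\mathrm{sos}})$.
   Context: Graphs are finite and simple. A set $D\subseteq V(G)$ is dominating in $G$ if every vertex of $V(G)\setminus D$ is adjacent to some vertex of $D$; $\gamma(G)$ is the minimum size of a dominating set. The Cartesian product $G\Box H$ has vertex set $V(G)\times V(H)$, with $gh$ and $g'h'$ adjacent iff ($g=g'$ and $hh'\in E(H)$) or ($h=h'$ and $gg'\in E(G)$). Let $\mathbb K\subseteq\mathbb R$ be a field with algebraic closure $\overline{\mathbb K}$. For an ideal $I\subseteq\mathbb K[y_1,\dots,y_n]$, $\mathcal V(I)=\{z\in\overline{\mathbb K}^n: f(z)=0\ \forall f\in I\}$. Given positive integers $k_{\mathcal G}\le n_{\mathcal G}$ and $k_{\mathcal H}\le n_{\mathcal H}$, fix a set $V(\mathcal G)$ of $n_{\mathcal G}$ vertices with a fixed subset $D_{\mathcal G}$ of size $k_{\mathcal G}$, and a set $V(\mathcal H)$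 of $n_{\mathcal H}$ vertices with a fixed subset $D_{\mathcal H}$ of size $k_{\mathcal H}$. Introduce variables $e_{gg'}=e_{g'g}$ for each 2-element subset $\{g,g'\}\subseteq V(\mathcal G)$, variables $e_{hh'}=e_{h'h}$ for each 2-element subset $\{h,h'\}\subseteq V(\mathcal H)$, and variables $x_{gh}$ for $g\in V(\mathcal G)$, $h\in V(\mathcal H)$ (all distinct). Let $P$ be the polynomial ring over $\mathbb K$ in all these variables. The ideal $I_{\mathrm{sos}}\subseteq P$ is generated by the following polynomials: - $e_{gg'}^2-e_{gg'}$ for $\{g,g'\}\subseteq V(\mathcal G)$; $\prod_{g'\in D_{\mathcal G}}(1-e_{gg'})$ for $g\in V(\mathcal G)\setminus D_{\mathcal G}$; $\prod_{g'\in V(\mathcal G)\setminus S}\bigl(\sum_{g\in S}e_{gg'}\bigr)$ for $S\subseteq V(\mathcal G)$ with $|S|=k_{\mathcal G}-1$; - the same three families with $\mathcal H$ in place of $\mathcal G$ (variables $e_{hh'}$, set $D_{\mathcal H}$, size $k_{\mathcal H}$); - $x_{gh}^2-x_{gh}$ and $(1-x_{gh})\prod_{g'\in V(\mathcal G),\,g'\ne g}(1-e_{gg'}x_{g'h})\prod_{h'\in V(\mathcal H),\,h'\neq h}(1-e_{hh'}x_{gh'})$ for $g\in V(\mathcal G)$, $h\in V(\mathcal H)$. *)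

theory Defs
  imports
    "Graph_Theory.Pair_Digraph"
    "HOL-Library.Poly_Mapping"
    "HOL-Library.FuncSet"
    "HOL-Library.Nonpos_Ints"
    "HOL-Library.Infinite_Typeclass"
    "HOL-Algebra.Algebraic_Closure_Type"
    "HOL-Computational_Algebra.Polynomial"
    Complex_Main
begin

section \<open>Domination and the Cartesian product\<close>

text \<open>
  A finite simple graph is a \<^const>\<open>pair_graph\<close>: a finite, loop-free, symmetric digraph whose
  arcs are pairs of vertices; the adjacency of \<open>u\<close> and \<open>v\<close> is \<open>(u, v) \<in> parcs G\<close>.
\<close>

definition dominating :: "'a pair_pre_digraph \<Rightarrow> 'a set \<Rightarrow> bool" where
  "dominating G D \<longleftrightarrow> D \<subseteq> pverts G \<and> (\<forall>v\<in>pverts G - D. \<exists>u\<in>D. (v, u) \<in> parcs G)"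

definition domination_number :: "'a pair_pre_digraph \<Rightarrow> nat" where
  "domination_number G = Min (card ` {D. dominating G D})"

definition cartesian_product ::
    "'a pair_pre_digraph \<Rightarrow> 'b pair_pre_digraph \<Rightarrow> ('a \<times> 'b) pair_pre_digraph" where
  "cartesian_product G H =
    \<lparr> pverts = pverts G \<times> pverts H,
      parcs = {((g, h), (g', h')) | g h g' h'.
        g \<in> pverts G \<and> g' \<in> pverts G \<and> h \<in> pverts H \<and> h' \<in> pverts H \<and>
        (g = g' \<and> (h, h') \<in> parcs H \<or> h = h' \<and> (g, g') \<in> parcs G)} \<rparr>"


section \<open>Polynomials, ideals and varieties over a subfield of the reals\<close>

text \<open>
  Monomials are finitely supported exponent functions, so a polynomial in variables of
  type \<open>'v\<close> is a finitely supported function from monomials to coefficients, with the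
  convolution product of \<^theory>\<open>HOL-Library.Poly_Mapping\<close>.
\<close>

type_synonym 'v mpoly = "('v \<Rightarrow>\<^sub>0 nat) \<Rightarrow>\<^sub>0 real"

definition mvar :: "'v \<Rightarrow> 'v mpoly" where
  "mvar v = Poly_Mapping.single (Poly_Mapping.single v 1) 1"

definition mpoly_ring :: "real set \<Rightarrow> 'v set \<Rightarrow> 'v mpoly ring" where
  "mpoly_ring K Vs = ring_of_type_algebra
    \<lparr> carrier := {p. \<forall>m\<in>Poly_Mapping.keys p.
        Poly_Mapping.lookup p m \<in> K \<and> Poly_Mapping.keys m \<subseteq> Vs} \<rparr>"

definition mpoly_eval :: "('v \<Rightarrow> complex) \<Rightarrow> 'v mpoly \<Rightarrow> complex" where
  "mpoly_eval z p = (\<Sum>m\<in>Poly_Mapping.keys p.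
     of_real (Poly_Mapping.lookup p m) *
     (\<Prod>v\<in>Poly_Mapping.keys m. z v ^ Poly_Mapping.lookup m v))"

text \<open>
  The algebraic closure of \<open>K \<subseteq> \<real>\<close> is realised inside the complex numbers, so that
  nonnegativity of a value is meaningful.
\<close>

definition algebraic_closure_in_complex :: "real set \<Rightarrow> complex set" where
  "algebraic_closure_in_complex K =
    {x. \<exists>p :: complex poly. p \<noteq> 0 \<and> (\<forall>i. Polynomial.coeff p i \<in> of_real ` K) \<and> poly p x = 0}"

definition variety :: "real set \<Rightarrow> 'v set \<Rightarrow> 'v mpoly set \<Rightarrow> ('v \<Rightarrow> complex) set" where
  "variety K Vs I =
    {z \<in> Vs \<rightarrow>\<^sub>E algebraic_closure_in_complex K. \<forall>p\<in>I. mpoly_eval z p = 0}"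


section \<open>The ideal of Vizing's conjecture\<close>

text \<open>
  Edge variables are indexed by vertex sets (used for two-element sets only), which makes
  the variables of \<open>{u, v}\<close> and \<open>{v, u}\<close> equal.
\<close>

datatype ('a, 'b) sos_var = EdgeG "'a set" | EdgeH "'b set" | Dom 'a 'b

definition sos_vars :: "'a set \<Rightarrow> 'b set \<Rightarrow> ('a, 'b) sos_var set" where
  "sos_vars VG VH =
     EdgeG ` {S. S \<subseteq> VG \<and> card S = 2} \<union> EdgeH ` {S. S \<subseteq> VH \<and> card S = 2} \<union>
     {Dom g h | g h. g \<in> VG \<and> h \<in> VH}"

abbreviation eG :: "'a \<Rightarrow> 'a \<Rightarrow> ('a, 'b) sos_var mpoly" where
  "eG g g' \<equiv> mvar (EdgeG {g, g'})"

abbreviation eH :: "'b \<Rightarrow> 'b \<Rightarrow> ('a, 'b) sos_var mpoly" where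
  "eH h h' \<equiv> mvar (EdgeH {h, h'})"

abbreviation xGH :: "'a \<Rightarrow> 'b \<Rightarrow> ('a, 'b) sos_var mpoly" where
  "xGH g h \<equiv> mvar (Dom g h)"

definition graph_gens ::
    "('c \<Rightarrow> 'c \<Rightarrow> 'v mpoly) \<Rightarrow> 'c set \<Rightarrow> 'c set \<Rightarrow> nat \<Rightarrow> 'v mpoly set" where
  "graph_gens e V D k =
     {(e v w)\<^sup>2 - e v w | v w. v \<in> V \<and> w \<in> V \<and> v \<noteq> w} \<union>
     {\<Prod>w\<in>D. (1 - e v w) | v. v \<in> V - D} \<union>
     {\<Prod>w\<in>V - S. (\<Sum>v\<in>S. e v w) | S. S \<subseteq> V \<and> card S = k - 1}"

definition product_gens :: "'a set \<Rightarrow> 'b set \<Rightarrow> ('a, 'b) sos_var mpoly set" where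
  "product_gens VG VH =
     {(xGH g h)\<^sup>2 - xGH g h | g h. g \<in> VG \<and> h \<in> VH} \<union>
     {(1 - xGH g h) * (\<Prod>g'\<in>VG - {g}. (1 - eG g g' * xGH g' h))
        * (\<Prod>h'\<in>VH - {h}. (1 - eH h h' * xGH g h')) | g h. g \<in> VG \<and> h \<in> VH}"

definition I_sos :: "real set \<Rightarrow> 'a set \<Rightarrow> 'a set \<Rightarrow> nat \<Rightarrow> 'b set \<Rightarrow> 'b set \<Rightarrow> nat
    \<Rightarrow> ('a, 'b) sos_var mpoly set" where
  "I_sos K VG DG kG VH DH kH =
     Idl\<^bsub>mpoly_ring K (sos_vars VG VH)\<^esub>
       (graph_gens eG VG DG kG \<union> graph_gens eH VH DH kH \<union> product_gens VG VH)"

definition f_star :: "'a set \<Rightarrow> nat \<Rightarrow> 'b set \<Rightarrow> nat \<Rightarrow> ('a, 'b) sos_var mpoly" where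
  "f_star VG kG VH kH = (\<Sum>(g, h)\<in>VG \<times> VH. xGH g h) - of_nat (kG * kH)"

end

(*
  A point of the variety has all coordinates in {0, 1}: its edge coordinates are two graphs on the
  fixed vertex sets in which the fixed sets are minimum dominating sets, and its remaining coordinates
  are the indicator function of a dominating set of the Cartesian product. At such a point f* is the
  size of this set minus the product of the two domination numbers. Conversely, every pair of
  nonempty graphs can be relabelled so that a minimum dominating set of each is the prescribed one.
*)
theory Submission
  imports Defs
begin

section \<open>Evaluation of polynomials and vanishing of generated ideals\<close>

text \<open>The variety is cut out by an ideal of a polynomial ring over \<open>K\<close>, yet only
  the generators have a combinatorial reading. Evaluation at a point is a ring homomorphism whose
  kernel is an ideal, so vanishing on the generators already gives vanishing on the ideal. At 0/1
  values a product vanishes exactly when some factor does, so products express existential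
  statements. Sums occur only in the family indexed by sets of size \<open>k - 1\<close>, and there
  characteristic 0 is essential: a sum of zeros and ones vanishes only if every summand does. That
  one cardinality suffices because supersets of dominating sets are dominating. Two mismatches
  remain. The graphs of (i) live on types \<open>'c\<close> and \<open>'d\<close>, the fixed sets on
  \<open>'a\<close> and \<open>'b\<close>, and a statement cannot quantify over types; hence graphs
  are relabelled, in one direction into infinite types and in the other onto the prescribed sets.
  Moreover (ii) has positive parameters, whereas the empty graph has domination number 0; for it the
  inequality is trivial.\<close>

lemma mpoly_eval_eq_sum:
  assumes "finite A" "Poly_Mapping.keys p \<subseteq> A"
  shows "mpoly_eval z p = (\<Sum>m\<in>A. of_real (Poly_Mapping.lookup p m) *
           (\<Prod>v\<in>Poly_Mapping.keys m. z v ^ Poly_Mapping.lookup m v))"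
  unfolding mpoly_eval_def
  using assms by (intro sum.mono_neutral_left) (auto simp: in_keys_iff)

lemma mpoly_eval_0 [simp]: "mpoly_eval z 0 = 0"
  by (simp add: mpoly_eval_def)

lemma mpoly_eval_1 [simp]: "mpoly_eval z 1 = 1"
  by (simp add: mpoly_eval_def)

lemma mpoly_eval_mvar [simp]: "mpoly_eval z (mvar v) = z v"
  by (simp add: mpoly_eval_def mvar_def)

lemma mpoly_eval_single:
  "mpoly_eval z (Poly_Mapping.single m a) =
     of_real a * (\<Prod>v\<in>Poly_Mapping.keys m. z v ^ Poly_Mapping.lookup m v)"
  by (simp add: mpoly_eval_def)

lemma mpoly_eval_add [simp]: "mpoly_eval z (p + q) = mpoly_eval z p + mpoly_eval z q"
proof -
  have "finite (Poly_Mapping.keys p \<union> Poly_Mapping.keys q)"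
    by simp
  then show ?thesis
    by (simp add: mpoly_eval_eq_sum[of "Poly_Mapping.keys p \<union> Poly_Mapping.keys q"]
        keys_add lookup_add algebra_simps sum.distrib)
qed

lemma mpoly_eval_uminus [simp]: "mpoly_eval z (- p) = - mpoly_eval z p"
  by (metis mpoly_eval_0 mpoly_eval_add add.right_inverse add_eq_0_iff)

lemma mpoly_eval_diff [simp]: "mpoly_eval z (p - q) = mpoly_eval z p - mpoly_eval z q"
  using mpoly_eval_add[of z p "- q"] by simp

lemma mpoly_eval_sum [simp]: "mpoly_eval z (sum f A) = (\<Sum>i\<in>A. mpoly_eval z (f i))"
  by (induction A rule: infinite_finite_induct) auto

lemma mpoly_eval_of_nat [simp]: "mpoly_eval z (of_nat n) = of_nat n"
  by (induction n) auto

text \<open>Both supports are enlarged to one index set. This is harmless: a variable outside the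
  support has exponent 0 and contributes the factor 1, even where \<open>z\<close> is 0.\<close>

lemma monomial_value_add:
  fixes z :: "'v \<Rightarrow> complex"
  shows "(\<Prod>v\<in>Poly_Mapping.keys (m + n). z v ^ Poly_Mapping.lookup (m + n) v) =
    (\<Prod>v\<in>Poly_Mapping.keys m. z v ^ Poly_Mapping.lookup m v) *
    (\<Prod>v\<in>Poly_Mapping.keys n. z v ^ Poly_Mapping.lookup n v)"
proof -
  define A where "A = Poly_Mapping.keys m \<union> Poly_Mapping.keys n"
  have extend: "(\<Prod>v\<in>Poly_Mapping.keys l. z v ^ Poly_Mapping.lookup l v) =
      (\<Prod>v\<in>A. z v ^ Poly_Mapping.lookup l v)" if "Poly_Mapping.keys l \<subseteq> A" for l
    using that by (intro prod.mono_neutral_left) (auto simp: A_def in_keys_iff)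
  have "Poly_Mapping.keys (m + n) \<subseteq> A" "Poly_Mapping.keys m \<subseteq> A" "Poly_Mapping.keys n \<subseteq> A"
    unfolding A_def by (auto dest: subsetD[OF keys_add])
  then show ?thesis
    by (simp only: extend) (simp add: lookup_add power_add prod.distrib)
qed

text \<open>Updating at a fresh key amounts to adding a single term, so claims additive in a
  polynomial can be checked on single terms.\<close>

lemma poly_mapping_single_add_induct [case_names zero single_add]:
  assumes "P 0" "\<And>m a p. P p \<Longrightarrow> P (Poly_Mapping.single m a + p)"
  shows "P p"
proof (induction p rule: Poly_Mapping.update_induct)
  case const
  show ?case by fact
next
  case (update p m a)
  have "Poly_Mapping.update m a p = Poly_Mapping.single m a + p"
    using update by (intro poly_mapping_eqI) (auto simp: lookup_update lookup_add lookup_single in_keys_iff)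
  with assms(2) update show ?case by simp
qed

text \<open>Both sides are additive in \<open>p\<close> and in \<open>q\<close>; two inductions
  leave a product of single terms, which is \<open>monomial_value_add\<close>.\<close>

lemma mpoly_eval_mult [simp]: "mpoly_eval z (p * q) = mpoly_eval z p * mpoly_eval z q"
proof (induction p rule: poly_mapping_single_add_induct)
  case (single_add m a p)
  have "mpoly_eval z (Poly_Mapping.single m a * q) =
      mpoly_eval z (Poly_Mapping.single m a) * mpoly_eval z q"
  proof (induction q rule: poly_mapping_single_add_induct)
    case (single_add n b q)
    then show ?case
      by (simp add: distrib_left mult_single mpoly_eval_single monomial_value_add)
  qed simp
  with single_add show ?case
    by (simp add: distrib_right)
qed simp

lemma poly_mapping_sum_singles:
  "(\<Sum>m\<in>Poly_Mapping.keys p. Poly_Mapping.single m (Poly_Mapping.lookup p m)) = p"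
  by (rule poly_mapping_eqI) (simp add: lookup_sum lookup_single when_def in_keys_iff)

lemma mpoly_eval_prod [simp]: "mpoly_eval z (prod f A) = (\<Prod>i\<in>A. mpoly_eval z (f i))"
  by (induction A rule: infinite_finite_induct) auto

lemma mpoly_eval_power [simp]: "mpoly_eval z (p ^ n) = mpoly_eval z p ^ n"
  by (induction n) auto

section \<open>Polynomials over \<open>K\<close> as a subring, and evaluation on generated
  ideals\<close>

lemma ring_of_type_algebra_simps [simp]:
  "carrier ring_of_type_algebra = UNIV"
  "x \<oplus>\<^bsub>ring_of_type_algebra\<^esub> y = x + y"
  "x \<otimes>\<^bsub>ring_of_type_algebra\<^esub> y = x * y"
  "\<zero>\<^bsub>ring_of_type_algebra\<^esub> = 0"
  "\<one>\<^bsub>ring_of_type_algebra\<^esub> = 1"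
  by (simp_all add: ring_of_type_algebra_def)

lemma a_inv_ring_of_type_algebra [simp]:
  "\<ominus>\<^bsub>ring_of_type_algebra\<^esub> (x :: 'a :: comm_ring_1) = - x"
proof -
  interpret ring "ring_of_type_algebra :: 'a ring"
    by (rule ring_from_type_algebra)
  show ?thesis
    by (rule minus_equality) simp_all
qed

context
  fixes K :: "real set"
  assumes K: "subring K (ring_of_type_algebra :: real ring)"
begin

lemma K_closed:
  "0 \<in> K" "1 \<in> K" "x \<in> K \<Longrightarrow> - x \<in> K" "x \<in> K \<Longrightarrow> y \<in> K \<Longrightarrow> x + y \<in> K"
  "x \<in> K \<Longrightarrow> y \<in> K \<Longrightarrow> x * y \<in> K"
proof -
  interpret ring "ring_of_type_algebra :: real ring"
    by (rule ring_from_type_algebra)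
  show "0 \<in> K" "1 \<in> K" "x \<in> K \<Longrightarrow> - x \<in> K" "x \<in> K \<Longrightarrow> y \<in> K \<Longrightarrow> x + y \<in> K"
    "x \<in> K \<Longrightarrow> y \<in> K \<Longrightarrow> x * y \<in> K"
    using subringE[OF K] by auto
qed

lemma mem_carrier_mpoly_ring:
  "p \<in> carrier (mpoly_ring K Vs) \<longleftrightarrow>
    (\<forall>m. Poly_Mapping.lookup p m \<in> K \<and> (Poly_Mapping.lookup p m \<noteq> 0 \<longrightarrow> Poly_Mapping.keys m \<subseteq> Vs))"
  using K_closed(1) by (auto simp: mpoly_ring_def in_keys_iff)

lemma mpoly_ring_closed:
  "0 \<in> carrier (mpoly_ring K Vs)"
  "1 \<in> carrier (mpoly_ring K Vs)"
  "v \<in> Vs \<Longrightarrow> mvar v \<in> carrier (mpoly_ring K Vs)"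
  "p \<in> carrier (mpoly_ring K Vs) \<Longrightarrow> - p \<in> carrier (mpoly_ring K Vs)"
  "p \<in> carrier (mpoly_ring K Vs) \<Longrightarrow> q \<in> carrier (mpoly_ring K Vs) \<Longrightarrow>
     p + q \<in> carrier (mpoly_ring K Vs)"
  using K_closed
  by (auto simp: mem_carrier_mpoly_ring mvar_def lookup_single lookup_one lookup_add when_def)
    (metis add_0 subsetD)

lemma single_in_mpoly_ring:
  "a \<in> K \<Longrightarrow> Poly_Mapping.keys m \<subseteq> Vs \<Longrightarrow> Poly_Mapping.single m a \<in> carrier (mpoly_ring K Vs)"
  using K_closed(1) by (auto simp: mem_carrier_mpoly_ring lookup_single when_def subset_iff)

lemma mpoly_ring_sum_closed:
  "(\<And>i. i \<in> A \<Longrightarrow> f i \<in> carrier (mpoly_ring K Vs)) \<Longrightarrow> sum f A \<in> carrier (mpoly_ring K Vs)"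
  by (induction A rule: infinite_finite_induct) (auto intro: mpoly_ring_closed)

text \<open>Expanding both factors into terms avoids the convolution formula: each term of the
  product has a monomial \<open>m + n\<close>, whose variables come from the two factors, and a
  coefficient that is a product in \<open>K\<close>.\<close>

lemma mpoly_ring_mult_closed:
  assumes p: "p \<in> carrier (mpoly_ring K Vs)" and q: "q \<in> carrier (mpoly_ring K Vs)"
  shows "p * q \<in> carrier (mpoly_ring K Vs)"
proof -
  have "p * q =
      (\<Sum>m\<in>Poly_Mapping.keys p. Poly_Mapping.single m (Poly_Mapping.lookup p m)) *
      (\<Sum>n\<in>Poly_Mapping.keys q. Poly_Mapping.single n (Poly_Mapping.lookup q n))"
    by (simp only: poly_mapping_sum_singles)
  also have "\<dots> = (\<Sum>m\<in>Poly_Mapping.keys p. \<Sum>n\<in>Poly_Mapping.keys q.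
      Poly_Mapping.single (m + n) (Poly_Mapping.lookup p m * Poly_Mapping.lookup q n))"
    by (simp add: sum_product mult_single)
  also have "\<dots> \<in> carrier (mpoly_ring K Vs)"
    using p q K_closed(5)
    by (intro mpoly_ring_sum_closed single_in_mpoly_ring order.trans[OF keys_add])
      (auto simp: mem_carrier_mpoly_ring in_keys_iff)
  finally show ?thesis .
qed

lemma mpoly_ring_diff_closed:
  assumes "p \<in> carrier (mpoly_ring K Vs)" "q \<in> carrier (mpoly_ring K Vs)"
  shows "p - q \<in> carrier (mpoly_ring K Vs)"
  using assms mpoly_ring_closed(4,5)[of _ Vs] by (metis diff_conv_add_uminus)

lemma mpoly_ring_prod_closed:
  "(\<And>i. i \<in> A \<Longrightarrow> f i \<in> carrier (mpoly_ring K Vs)) \<Longrightarrow> prod f A \<in> carrier (mpoly_ring K Vs)"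
  by (induction A rule: infinite_finite_induct)
    (auto intro: mpoly_ring_closed mpoly_ring_mult_closed)

lemma mpoly_ring_power_closed:
  "p \<in> carrier (mpoly_ring K Vs) \<Longrightarrow> p ^ n \<in> carrier (mpoly_ring K Vs)"
  by (induction n) (auto intro: mpoly_ring_closed mpoly_ring_mult_closed)

lemmas mpoly_ring_intros = mpoly_ring_closed mpoly_ring_diff_closed mpoly_ring_sum_closed
  mpoly_ring_mult_closed mpoly_ring_prod_closed mpoly_ring_power_closed

lemma mpoly_ring_ops [simp]:
  "x \<oplus>\<^bsub>mpoly_ring K Vs\<^esub> y = x + y"
  "x \<otimes>\<^bsub>mpoly_ring K Vs\<^esub> y = x * y"
  "\<one>\<^bsub>mpoly_ring K Vs\<^esub> = 1"
  by (simp_all add: mpoly_ring_def)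

text \<open>The carrier is a subring of the full polynomial ring on the type, from which the ring
  axioms are inherited.\<close>

lemma ring_mpoly_ring: "ring (mpoly_ring K (Vs :: 'v set))"
proof -
  let ?P = "ring_of_type_algebra :: 'v mpoly ring"
  interpret ring ?P
    by (rule ring_from_type_algebra)
  have "mpoly_ring K Vs = ?P\<lparr>carrier := carrier (mpoly_ring K Vs)\<rparr>"
    by (simp add: mpoly_ring_def)
  moreover have "subring (carrier (mpoly_ring K Vs)) ?P"
    by (rule subringI) (auto intro: mpoly_ring_intros)
  ultimately show ?thesis
    using subring_is_ring by metis
qed

lemma ring_hom_mpoly_eval:
  "ring_hom_ring (mpoly_ring K Vs) (ring_of_type_algebra :: complex ring) (mpoly_eval z)"
  by (rule ring_hom_ringI[OF ring_mpoly_ring ring_from_type_algebra]) simp_all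

text \<open>The kernel of \<open>mpoly_eval z\<close> is an ideal, hence contains the generated
  ideal once it contains \<open>S\<close>.\<close>

lemma mpoly_eval_vanishes_on_genideal:
  assumes gens: "S \<subseteq> carrier (mpoly_ring K Vs)"
  shows "(\<forall>p\<in>Idl\<^bsub>mpoly_ring K Vs\<^esub> S. mpoly_eval z p = 0) \<longleftrightarrow> (\<forall>p\<in>S. mpoly_eval z p = 0)"
proof
  assume "\<forall>p\<in>Idl\<^bsub>mpoly_ring K Vs\<^esub> S. mpoly_eval z p = 0"
  then show "\<forall>p\<in>S. mpoly_eval z p = 0"
    using ring.genideal_self[OF ring_mpoly_ring gens] by blast
next
  let ?ker = "a_kernel (mpoly_ring K Vs) (ring_of_type_algebra :: complex ring) (mpoly_eval z)"
  have ker: "?ker = {p \<in> carrier (mpoly_ring K Vs). mpoly_eval z p = 0}"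
    by (simp add: a_kernel_def')
  assume "\<forall>p\<in>S. mpoly_eval z p = 0"
  with gens have "S \<subseteq> ?ker"
    unfolding ker by blast
  then have "Idl\<^bsub>mpoly_ring K Vs\<^esub> S \<subseteq> ?ker"
    by (rule ring.genideal_minimal[OF ring_mpoly_ring
          ring_hom_ring.kernel_is_ideal[OF ring_hom_mpoly_eval]])
  then show "\<forall>p\<in>Idl\<^bsub>mpoly_ring K Vs\<^esub> S. mpoly_eval z p = 0"
    unfolding ker by blast
qed

end

lemma graph_gens_closed:
  assumes "subring K (ring_of_type_algebra :: real ring)"
    and "finite V" "D \<subseteq> V"
    and "\<And>v w. v \<in> V \<Longrightarrow> w \<in> V \<Longrightarrow> v \<noteq> w \<Longrightarrow> e v w \<in> carrier (mpoly_ring K Vs)"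
  shows "graph_gens e V D k \<subseteq> carrier (mpoly_ring K Vs)"
  using assms unfolding graph_gens_def
  by (auto intro!: mpoly_ring_intros[OF assms(1)])

lemma product_gens_closed:
  assumes "subring K (ring_of_type_algebra :: real ring)"
  shows "product_gens VG VH \<subseteq> carrier (mpoly_ring K (sos_vars VG VH))"
  unfolding product_gens_def
  by (auto intro!: mpoly_ring_intros[OF assms] simp: sos_vars_def)

lemma mem_variety_I_sos:
  fixes z :: "('a, 'b) sos_var \<Rightarrow> complex"
  assumes K: "subring K (ring_of_type_algebra :: real ring)"
    and "finite VG" "DG \<subseteq> VG" "finite VH" "DH \<subseteq> VH"
  shows "z \<in> variety K (sos_vars VG VH) (I_sos K VG DG kG VH DH kH) \<longleftrightarrow>
    z \<in> sos_vars VG VH \<rightarrow>\<^sub>E algebraic_closure_in_complex K \<and>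
    (\<forall>p\<in>graph_gens eG VG DG kG. mpoly_eval z p = 0) \<and>
    (\<forall>p\<in>graph_gens eH VH DH kH. mpoly_eval z p = 0) \<and>
    (\<forall>p\<in>product_gens VG VH. mpoly_eval z p = 0)"
proof -
  have "eG v w \<in> carrier (mpoly_ring K (sos_vars VG VH))" if "v \<in> VG" "w \<in> VG" "v \<noteq> w" for v w
    using that by (intro mpoly_ring_closed[OF K]) (auto simp: sos_vars_def)
  moreover have "eH v w \<in> carrier (mpoly_ring K (sos_vars VG VH))"
    if "v \<in> VH" "w \<in> VH" "v \<noteq> w" for v w
    using that by (intro mpoly_ring_closed[OF K]) (auto simp: sos_vars_def)
  ultimately have "graph_gens eG VG DG kG \<union> graph_gens eH VH DH kH \<union> product_gens VG VH
      \<subseteq> carrier (mpoly_ring K (sos_vars VG VH))"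
    using assms by (intro Un_least graph_gens_closed product_gens_closed)
  then show ?thesis
    unfolding variety_def I_sos_def mem_Collect_eq
    by (simp only: mpoly_eval_vanishes_on_genideal[OF K] ball_Un conj_assoc)
qed

section \<open>Domination numbers\<close>

lemma dominating_verts: "dominating G (pverts G)"
  by (simp add: dominating_def)

lemma dominating_mono: "dominating G D \<Longrightarrow> D \<subseteq> D' \<Longrightarrow> D' \<subseteq> pverts G \<Longrightarrow> dominating G D'"
  unfolding dominating_def by blast

lemma finite_dominating: "finite (pverts G) \<Longrightarrow> finite {D. dominating G D}"
  by (rule finite_subset[of _ "Pow (pverts G)"]) (auto simp: dominating_def)

lemma domination_number_le:
  assumes "finite (pverts G)" "dominating G D"
  shows "domination_number G \<le> card D"
  unfolding domination_number_def using assms by (intro Min_le) (auto simp: finite_dominating)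

lemma domination_number_le_card: "finite (pverts G) \<Longrightarrow> domination_number G \<le> card (pverts G)"
  using domination_number_le dominating_verts by blast

lemma obtain_minimum_dominating:
  assumes "finite (pverts G)"
  obtains D where "dominating G D" "card D = domination_number G"
proof -
  have "domination_number G \<in> card ` {D. dominating G D}"
    unfolding domination_number_def
    using assms dominating_verts by (intro Min_in) (auto simp: finite_dominating)
  then show thesis
    using that by auto
qed

text \<open>A dominating set with fewer than \<open>k\<close> elements can be padded with vertices
  to size exactly \<open>k - 1\<close> and still dominates, so minimality is tested at the one
  cardinality that occurs in \<open>graph_gens\<close>. Positivity of \<open>k\<close> keeps
  \<open>k - 1\<close> below \<open>k\<close>.\<close>

lemma domination_number_eq_iff:
  assumes fin: "finite (pverts G)" and D: "dominating G D" "card D = k" and "0 < k"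
  shows "domination_number G = k \<longleftrightarrow> (\<forall>S. S \<subseteq> pverts G \<longrightarrow> card S = k - 1 \<longrightarrow> \<not> dominating G S)"
proof
  assume "domination_number G = k"
  then show "\<forall>S. S \<subseteq> pverts G \<longrightarrow> card S = k - 1 \<longrightarrow> \<not> dominating G S"
    using domination_number_le[OF fin] \<open>0 < k\<close> by fastforce
next
  assume none: "\<forall>S. S \<subseteq> pverts G \<longrightarrow> card S = k - 1 \<longrightarrow> \<not> dominating G S"
  obtain M where M: "dominating G M" "card M = domination_number G"
    using obtain_minimum_dominating fin by blast
  have le: "domination_number G \<le> k"
    using domination_number_le[OF fin D(1)] D(2) by simp
  have "k \<le> card (pverts G)"
    using D fin card_mono by (auto simp: dominating_def)
  have "\<not> domination_number G \<le> k - 1"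
  proof
    assume "domination_number G \<le> k - 1"
    then obtain S where "M \<subseteq> S" "S \<subseteq> pverts G" "card S = k - 1"
      using exists_subset_between[of M "k - 1" "pverts G"] M fin \<open>k \<le> card (pverts G)\<close>
      unfolding dominating_def by (metis diff_le_self le_trans)
    then show False
      using none dominating_mono M(1) by blast
  qed
  with le show "domination_number G = k"
    by simp
qed

lemma pair_graph_sym: "pair_graph G \<Longrightarrow> (u, v) \<in> parcs G \<Longrightarrow> (v, u) \<in> parcs G"
  by (meson pair_graph.axioms(2) pair_pseudo_graph.axioms(2) pair_sym_digraph.arcs_symmetric)

text \<open>Replaces the locale by conditions that can be checked directly on relabelled and decoded
  graphs.\<close>

lemma pair_graph_iff:
  "pair_graph G \<longleftrightarrow> finite (pverts G) \<and> parcs G \<subseteq> pverts G \<times> pverts G \<and> sym (parcs G) \<and> irrefl (parcs G)"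
proof
  assume G: "pair_graph G"
  interpret pair_graph G by fact
  show "finite (pverts G) \<and> parcs G \<subseteq> pverts G \<times> pverts G \<and> sym (parcs G) \<and> irrefl (parcs G)"
    using pair_finite_verts wellformed' pair_graph_sym[OF G] no_loops'
    by (auto simp: sym_def irrefl_def) blast
next
  assume "finite (pverts G) \<and> parcs G \<subseteq> pverts G \<times> pverts G \<and> sym (parcs G) \<and> irrefl (parcs G)"
  then show "pair_graph G"
    by unfold_locales
      (auto simp: symmetric_def irrefl_def intro: finite_subset[OF _ finite_cartesian_product])
qed

section \<open>Cartesian products and relabelling of vertices\<close>

lemma pverts_cartesian_product [simp]:
  "pverts (cartesian_product G H) = pverts G \<times> pverts H"
  by (simp add: cartesian_product_def)

lemma parcs_cartesian_product:
  "parcs G \<subseteq> pverts G \<times> pverts G \<Longrightarrow> parcs H \<subseteq> pverts H \<times> pverts H \<Longrightarrow>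
   ((g, h), (g', h')) \<in> parcs (cartesian_product G H) \<longleftrightarrow>
     g \<in> pverts G \<and> g = g' \<and> (h, h') \<in> parcs H \<or> h \<in> pverts H \<and> h = h' \<and> (g, g') \<in> parcs G"
  unfolding cartesian_product_def by auto

text \<open>An isomorphic copy once \<open>f\<close> is injective on the vertices. It serves both to
  change the vertex type and to move a minimum dominating set onto a prescribed set.\<close>

definition map_graph :: "('a \<Rightarrow> 'b) \<Rightarrow> 'a pair_pre_digraph \<Rightarrow> 'b pair_pre_digraph" where
  "map_graph f G = \<lparr>pverts = f ` pverts G, parcs = map_prod f f ` parcs G\<rparr>"

lemma pverts_map_graph [simp]: "pverts (map_graph f G) = f ` pverts G"
  by (simp add: map_graph_def)

lemma parcs_map_graph:
  assumes "inj_on f (pverts G)" "parcs G \<subseteq> pverts G \<times> pverts G" "u \<in> pverts G" "v \<in> pverts G"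
  shows "(f u, f v) \<in> parcs (map_graph f G) \<longleftrightarrow> (u, v) \<in> parcs G"
proof
  assume "(f u, f v) \<in> parcs (map_graph f G)"
  then obtain u' v' where "(u', v') \<in> parcs G" "f u = f u'" "f v = f v'"
    by (auto simp: map_graph_def)
  moreover from this have "u' = u" "v' = v"
    using assms by (auto dest: inj_onD)
  ultimately show "(u, v) \<in> parcs G"
    by simp
qed (auto simp: map_graph_def)

lemma pair_graph_map_graph:
  assumes "pair_graph G" "inj_on f (pverts G)"
  shows "pair_graph (map_graph f G)"
proof -
  have "irrefl (map_prod f f ` parcs G)"
    using assms by (auto simp: pair_graph_iff irrefl_def inj_on_def)
  moreover have "sym (map_prod f f ` parcs G)"
  proof (rule symI)
    fix a b assume "(a, b) \<in> map_prod f f ` parcs G"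
    then obtain u v where "(u, v) \<in> parcs G" "a = f u" "b = f v"
      by auto
    with pair_graph_sym[OF assms(1)] show "(b, a) \<in> map_prod f f ` parcs G"
      by (metis image_eqI map_prod_simp)
  qed
  moreover have "map_prod f f ` parcs G \<subseteq> f ` pverts G \<times> f ` pverts G"
    using assms(1) by (auto simp: pair_graph_iff)
  ultimately show ?thesis
    using assms(1) by (simp add: pair_graph_iff map_graph_def)
qed

lemma dominating_map_graph:
  assumes "inj_on f (pverts G)" "parcs G \<subseteq> pverts G \<times> pverts G" "D \<subseteq> pverts G"
  shows "dominating (map_graph f G) (f ` D) \<longleftrightarrow> dominating G D"
proof -
  have "f ` pverts G - f ` D = f ` (pverts G - D)"
    using assms by (simp add: inj_on_image_set_diff)
  moreover have "(\<exists>u\<in>D. (f v, f u) \<in> parcs (map_graph f G)) \<longleftrightarrow> (\<exists>u\<in>D. (v, u) \<in> parcs G)"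
    if "v \<in> pverts G" for v
    using that assms(3) parcs_map_graph[OF assms(1,2), of v] by (meson subsetD)
  ultimately show ?thesis
    using assms(3) by (simp add: dominating_def image_mono)
qed

text \<open>Every vertex set of the copy is an image, so taking images matches up the dominating
  sets, and injectivity preserves their sizes.\<close>

lemma domination_number_map_graph:
  assumes "inj_on f (pverts G)" "parcs G \<subseteq> pverts G \<times> pverts G"
  shows "domination_number (map_graph f G) = domination_number G"
proof -
  have "{D. dominating (map_graph f G) D} = (`) f ` {D. dominating G D}"
  proof (intro equalityI subsetI)
    fix D assume "D \<in> {D. dominating (map_graph f G) D}"
    then obtain D' where "D' \<subseteq> pverts G" "D = f ` D'"
      by (auto simp: dominating_def subset_image_iff)
    with \<open>D \<in> _\<close> show "D \<in> (`) f ` {D. dominating G D}"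
      using dominating_map_graph[OF assms] by auto
  next
    fix D assume "D \<in> (`) f ` {D. dominating G D}"
    then obtain D' where "dominating G D'" "D = f ` D'"
      by blast
    moreover from this have "D' \<subseteq> pverts G"
      by (simp add: dominating_def)
    ultimately show "D \<in> {D. dominating (map_graph f G) D}"
      using dominating_map_graph[OF assms] by simp
  qed
  moreover have "card (f ` D) = card D" if "dominating G D" for D
    using that assms(1) by (auto simp: dominating_def intro: card_image inj_on_subset)
  ultimately show ?thesis
    unfolding domination_number_def by (simp add: image_image cong: image_cong_simp)
qed

text \<open>Each adjacency in the product involves an equality of coordinates; injectivity of
  \<open>f\<close> and \<open>f'\<close> is what reflects it back to the original vertices.\<close>

lemma cartesian_product_map_graph:
  assumes "inj_on f (pverts G)" "parcs G \<subseteq> pverts G \<times> pverts G"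
    and "inj_on f' (pverts H)" "parcs H \<subseteq> pverts H \<times> pverts H"
  shows "cartesian_product (map_graph f G) (map_graph f' H) =
    map_graph (map_prod f f') (cartesian_product G H)"
proof -
  have arcs: "parcs (cartesian_product (map_graph f G) (map_graph f' H)) =
      parcs (map_graph (map_prod f f') (cartesian_product G H))" (is "?L = ?R")
  proof (intro equalityI subsetI)
    fix a assume "a \<in> ?L"
    then obtain g h g' h' where a: "a = ((f g, f' h), (f g', f' h'))"
      and verts: "g \<in> pverts G" "g' \<in> pverts G" "h \<in> pverts H" "h' \<in> pverts H"
      and "f g = f g' \<and> (f' h, f' h') \<in> parcs (map_graph f' H) \<or>
        f' h = f' h' \<and> (f g, f g') \<in> parcs (map_graph f G)"
      unfolding cartesian_product_def by auto
    then have "((g, h), (g', h')) \<in> parcs (cartesian_product G H)"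
      using assms parcs_map_graph[OF assms(1,2)] parcs_map_graph[OF assms(3,4)]
      by (auto simp: parcs_cartesian_product dest: inj_onD)
    then show "a \<in> ?R"
      unfolding a map_graph_def by (auto intro: rev_image_eqI)
  next
    fix a assume "a \<in> ?R"
    then obtain g h g' h' where "a = ((f g, f' h), (f g', f' h'))"
      and "((g, h), (g', h')) \<in> parcs (cartesian_product G H)"
      unfolding map_graph_def by auto
    then show "a \<in> ?L"
      using assms unfolding cartesian_product_def map_graph_def by auto
  qed
  have verts: "pverts (cartesian_product (map_graph f G) (map_graph f' H)) =
      pverts (map_graph (map_prod f f') (cartesian_product G H))"
    by auto
  show ?thesis
    by (rule pair_pre_digraph.equality[OF verts arcs]) simp
qed

lemma domination_number_cartesian_product_map_graph:
  assumes "pair_graph G" "pair_graph H" "inj_on f (pverts G)" "inj_on f' (pverts H)"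
  shows "domination_number (cartesian_product (map_graph f G) (map_graph f' H)) =
    domination_number (cartesian_product G H)"
proof -
  have arcs: "parcs G \<subseteq> pverts G \<times> pverts G" "parcs H \<subseteq> pverts H \<times> pverts H"
    using assms(1,2) by (simp_all add: pair_graph_iff)
  have "parcs (cartesian_product G H) \<subseteq>
      pverts (cartesian_product G H) \<times> pverts (cartesian_product G H)"
    by (auto simp: cartesian_product_def)
  then show ?thesis
    using assms(3,4) arcs
    by (simp add: cartesian_product_map_graph domination_number_map_graph map_prod_inj_on)
qed

section \<open>Points of the variety as pairs of graphs with a dominating set\<close>

text \<open>Values are attached to vertex sets, like the edge variables, so adjacency is symmetric
  automatically. Every value other than 1 counts as a non-edge, which makes the graph available
  before the values are known to be 0 or 1.\<close>

definition value_graph :: "'a set \<Rightarrow> ('a set \<Rightarrow> complex) \<Rightarrow> 'a pair_pre_digraph" where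
  "value_graph V c = \<lparr>pverts = V, parcs = {(u, w). u \<in> V \<and> w \<in> V \<and> u \<noteq> w \<and> c {u, w} = 1}\<rparr>"

lemma pverts_value_graph [simp]: "pverts (value_graph V c) = V"
  by (simp add: value_graph_def)

lemma mem_parcs_value_graph [simp]:
  "(u, w) \<in> parcs (value_graph V c) \<longleftrightarrow> u \<in> V \<and> w \<in> V \<and> u \<noteq> w \<and> c {u, w} = 1"
  by (simp add: value_graph_def)

lemma pair_graph_value_graph: "finite V \<Longrightarrow> pair_graph (value_graph V c)"
  by (auto simp: pair_graph_iff value_graph_def sym_def irrefl_def insert_commute)

lemma value_graph_indicator:
  assumes "pair_graph G"
  shows "value_graph (pverts G) (\<lambda>S. if \<exists>(u, w)\<in>parcs G. S = {u, w} then 1 else 0) = G"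
proof (rule pair_pre_digraph.equality)
  show "parcs (value_graph (pverts G) (\<lambda>S. if \<exists>(u, w)\<in>parcs G. S = {u, w} then 1 else 0)) = parcs G"
    using assms unfolding pair_graph_iff
    by (auto simp: value_graph_def doubleton_eq_iff sym_def irrefl_def split: if_splits)
qed simp_all

text \<open>A point of the variety is prescribed only on the actual variables, so graphs must be
  compared through two-element subsets of \<open>V\<close> alone.\<close>

lemma value_graph_cong:
  assumes "\<And>u w. u \<in> V \<Longrightarrow> w \<in> V \<Longrightarrow> u \<noteq> w \<Longrightarrow> c {u, w} = c' {u, w}"
  shows "value_graph V c = value_graph V c'"
  using assms by (auto simp: value_graph_def)

lemma dominating_value_graph:
  "D \<subseteq> V \<Longrightarrow> dominating (value_graph V c) D \<longleftrightarrow> (\<forall>v\<in>V - D. \<exists>w\<in>D. c {v, w} = 1)"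
  by (simp add: dominating_def) blast

lemma ball_Collect_image:
  "(\<forall>p\<in>{f x | x. P x}. Q p) \<longleftrightarrow> (\<forall>x. P x \<longrightarrow> Q (f x))"
  "(\<forall>p\<in>{f' x y | x y. P' x y}. Q p) \<longleftrightarrow> (\<forall>x y. P' x y \<longrightarrow> Q (f' x y))"
  by blast+

text \<open>In order, the three families say that edge values are 0 or 1, that \<open>D\<close>
  dominates, and that no set of size \<open>k - 1\<close> does. The map \<open>E\<close> from vertex
  sets to variables lets one proof serve both factors.\<close>

lemma graph_gens_vanish_iff:
  fixes z :: "'v \<Rightarrow> complex" and E :: "'c set \<Rightarrow> 'v"
  assumes fin: "finite V" and D: "D \<subseteq> V" "card D = k" and k: "0 < k"
  shows "(\<forall>p\<in>graph_gens (\<lambda>v w. mvar (E {v, w})) V D k. mpoly_eval z p = 0) \<longleftrightarrow>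
    (\<forall>v\<in>V. \<forall>w\<in>V. v \<noteq> w \<longrightarrow> z (E {v, w}) \<in> {0, 1}) \<and>
    dominating (value_graph V (\<lambda>S. z (E S))) D \<and>
    domination_number (value_graph V (\<lambda>S. z (E S))) = k"
    (is "?L \<longleftrightarrow> ?bool \<and> ?dom \<and> ?number")
proof -
  let ?G = "value_graph V (\<lambda>S. z (E S))"
  let ?min = "\<forall>S. S \<subseteq> V \<longrightarrow> card S = k - 1 \<longrightarrow> \<not> dominating ?G S"
  have finite_subset: "finite S" if "S \<subseteq> V" for S
    using fin that by (rule rev_finite_subset)
  have "?L \<longleftrightarrow> (\<forall>v w. v \<in> V \<and> w \<in> V \<and> v \<noteq> w \<longrightarrow> (z (E {v, w}))\<^sup>2 - z (E {v, w}) = 0) \<and>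
      (\<forall>v\<in>V - D. (\<Prod>w\<in>D. 1 - z (E {v, w})) = 0) \<and>
      (\<forall>S. S \<subseteq> V \<and> card S = k - 1 \<longrightarrow> (\<Prod>w\<in>V - S. \<Sum>v\<in>S. z (E {v, w})) = 0)"
    unfolding graph_gens_def ball_Un ball_Collect_image by (simp add: Ball_def conj_assoc)
  also have "(\<forall>v w. v \<in> V \<and> w \<in> V \<and> v \<noteq> w \<longrightarrow> (z (E {v, w}))\<^sup>2 - z (E {v, w}) = 0) \<longleftrightarrow> ?bool"
    by (auto simp: power2_eq_square)
  \<comment> \<open>A factor vanishes exactly when \<open>v\<close> and \<open>w\<close> are
    adjacent.\<close>
  also have "(\<forall>v\<in>V - D. (\<Prod>w\<in>D. 1 - z (E {v, w})) = 0) \<longleftrightarrow> ?dom"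
    by (simp only: dominating_value_graph[OF D(1)] prod_zero_iff[OF finite_subset[OF D(1)]]
        right_minus_eq eq_commute[of "1 :: complex"])
  also have "?bool \<and> ?dom \<and>
      (\<forall>S. S \<subseteq> V \<and> card S = k - 1 \<longrightarrow> (\<Prod>w\<in>V - S. \<Sum>v\<in>S. z (E {v, w})) = 0) \<longleftrightarrow>
      ?bool \<and> ?dom \<and> ?min"
  proof (intro conj_cong refl)
    assume bool: ?bool
    have "(\<Prod>w\<in>V - S. \<Sum>v\<in>S. z (E {v, w})) = 0 \<longleftrightarrow> \<not> dominating ?G S" if S: "S \<subseteq> V" for S
    proof -
      \<comment> \<open>The factor for \<open>w\<close> vanishes exactly when \<open>w\<close> has
        no neighbour in \<open>S\<close>; the product therefore vanishes exactly when some vertex is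
        undominated.\<close>
      have "(\<Sum>v\<in>S. z (E {v, w})) = 0 \<longleftrightarrow> (\<forall>v\<in>S. z (E {w, v}) \<noteq> 1)" if w: "w \<in> V - S" for w
      proof -
        have indicator: "z (E {v, w}) = of_bool (z (E {w, v}) = 1)" if "v \<in> S" for v
          using that w bool S by (auto simp: insert_commute)
        \<comment> \<open>Complex summands might cancel. Being zeros and ones, they are moved to the
          natural numbers, where a sum is 0 only if all summands are.\<close>
        then have "(\<Sum>v\<in>S. z (E {v, w})) = (\<Sum>v\<in>S. of_nat (of_bool (z (E {w, v}) = 1)))"
          by simp
        also have "\<dots> = 0 \<longleftrightarrow> (\<Sum>v\<in>S. of_bool (z (E {w, v}) = 1) :: nat) = 0"
          by (simp only: of_nat_sum[symmetric] of_nat_eq_0_iff)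
        also have "\<dots> \<longleftrightarrow> (\<forall>v\<in>S. z (E {w, v}) \<noteq> 1)"
          using finite_subset[OF S] by auto
        finally show ?thesis .
      qed
      then show ?thesis
        using fin S by (simp add: dominating_value_graph prod_zero_iff)
    qed
    then show "(\<forall>S. S \<subseteq> V \<and> card S = k - 1 \<longrightarrow> (\<Prod>w\<in>V - S. \<Sum>v\<in>S. z (E {v, w})) = 0) \<longleftrightarrow> ?min"
      by blast
  qed
  also have "\<dots> \<longleftrightarrow> ?bool \<and> ?dom \<and> ?number"
    using domination_number_eq_iff[of ?G D k] fin D(2) k by auto
  finally show ?thesis .
qed

text \<open>The three factors of the second generator are the three ways to dominate
  \<open>(g, h)\<close>: by membership, along an edge of the first graph, or along an edge of the
  second.\<close>

lemma product_gens_vanish_iff: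
  fixes z :: "('a, 'b) sos_var \<Rightarrow> complex"
  assumes fin: "finite VG" "finite VH"
    and eG: "\<forall>g\<in>VG. \<forall>g'\<in>VG. g \<noteq> g' \<longrightarrow> z (EdgeG {g, g'}) \<in> {0, 1}"
    and eH: "\<forall>h\<in>VH. \<forall>h'\<in>VH. h \<noteq> h' \<longrightarrow> z (EdgeH {h, h'}) \<in> {0, 1}"
  shows "(\<forall>p\<in>product_gens VG VH. mpoly_eval z p = 0) \<longleftrightarrow>
    (\<forall>g\<in>VG. \<forall>h\<in>VH. z (Dom g h) \<in> {0, 1}) \<and>
    dominating (cartesian_product (value_graph VG (\<lambda>S. z (EdgeG S))) (value_graph VH (\<lambda>S. z (EdgeH S))))
      {(g, h). g \<in> VG \<and> h \<in> VH \<and> z (Dom g h) = 1}"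
    (is "?L \<longleftrightarrow> ?bool \<and> dominating ?P ?X")
proof -
  let ?gen = "\<lambda>g h. (1 - z (Dom g h)) * (\<Prod>g'\<in>VG - {g}. 1 - z (EdgeG {g, g'}) * z (Dom g' h)) *
    (\<Prod>h'\<in>VH - {h}. 1 - z (EdgeH {h, h'}) * z (Dom g h'))"
  have "?L \<longleftrightarrow> (\<forall>g\<in>VG. \<forall>h\<in>VH. (z (Dom g h))\<^sup>2 - z (Dom g h) = 0) \<and> (\<forall>g\<in>VG. \<forall>h\<in>VH. ?gen g h = 0)"
    unfolding product_gens_def ball_Un ball_Collect_image by (simp add: Ball_def imp_conjL)
  also have "(\<forall>g\<in>VG. \<forall>h\<in>VH. (z (Dom g h))\<^sup>2 - z (Dom g h) = 0) \<longleftrightarrow> ?bool"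
    by (auto simp: power2_eq_square)
  also have "?bool \<and> (\<forall>g\<in>VG. \<forall>h\<in>VH. ?gen g h = 0) \<longleftrightarrow> ?bool \<and> dominating ?P ?X"
  proof (intro conj_cong refl)
    assume bool: ?bool
    \<comment> \<open>Over the complex numbers \<open>a * b = 1\<close> alone would not make both
      factors 1; the restriction to 0 and 1 does.\<close>
    have one: "1 - a * b = 0 \<longleftrightarrow> a = 1 \<and> b = 1" if "a \<in> {0, 1}" "b \<in> {0, 1}" for a b :: complex
      using that by auto
    have gen: "?gen g h = 0 \<longleftrightarrow> z (Dom g h) = 1 \<or>
        (\<exists>g'\<in>VG - {g}. z (EdgeG {g, g'}) = 1 \<and> z (Dom g' h) = 1) \<or>
        (\<exists>h'\<in>VH - {h}. z (EdgeH {h, h'}) = 1 \<and> z (Dom g h') = 1)" if "g \<in> VG" "h \<in> VH" for g h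
    proof -
      have "1 - z (EdgeG {g, g'}) * z (Dom g' h) = 0 \<longleftrightarrow> z (EdgeG {g, g'}) = 1 \<and> z (Dom g' h) = 1"
        if "g' \<in> VG - {g}" for g'
        using that bool eG \<open>g \<in> VG\<close> \<open>h \<in> VH\<close> by (intro one) auto
      moreover have "1 - z (EdgeH {h, h'}) * z (Dom g h') = 0 \<longleftrightarrow> z (EdgeH {h, h'}) = 1 \<and> z (Dom g h') = 1"
        if "h' \<in> VH - {h}" for h'
        using that bool eH \<open>g \<in> VG\<close> \<open>h \<in> VH\<close> by (intro one) auto
      moreover have "1 - z (Dom g h) = 0 \<longleftrightarrow> z (Dom g h) = 1"
        by auto
      ultimately show ?thesis
        using fin by (simp only: mult_eq_0_iff prod_zero_iff finite_Diff) blast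
    qed
    have "dominating ?P ?X \<longleftrightarrow> (\<forall>g\<in>VG. \<forall>h\<in>VH. z (Dom g h) = 1 \<or>
        (\<exists>(g', h')\<in>?X. ((g, h), (g', h')) \<in> parcs ?P))"
      unfolding dominating_def by auto
    also have "\<dots> \<longleftrightarrow> (\<forall>g\<in>VG. \<forall>h\<in>VH. ?gen g h = 0)"
    proof (intro ball_cong refl)
      fix g h assume gh: "g \<in> VG" "h \<in> VH"
      \<comment> \<open>Loop-freeness is written as removal of \<open>h\<close> or \<open>g\<close>,
        to match the index ranges of the products in \<open>gen\<close>.\<close>
      have "((g, h), (g', h')) \<in> parcs ?P \<longleftrightarrow>
          g = g' \<and> h' \<in> VH - {h} \<and> z (EdgeH {h, h'}) = 1 \<or>
          h = h' \<and> g' \<in> VG - {g} \<and> z (EdgeG {g, g'}) = 1" for g' h'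
        using gh by (auto simp: cartesian_product_def)
      then show "z (Dom g h) = 1 \<or> (\<exists>(g', h')\<in>?X. ((g, h), (g', h')) \<in> parcs ?P) \<longleftrightarrow> ?gen g h = 0"
        unfolding gen[OF gh] using gh by auto
    qed
    finally show "(\<forall>g\<in>VG. \<forall>h\<in>VH. ?gen g h = 0) \<longleftrightarrow> dominating ?P ?X"
      by simp
  qed
  finally show ?thesis .
qed

section \<open>The value of \<open>f_star\<close> and its sign on the variety\<close>

lemma mpoly_eval_f_star:
  assumes "finite VG" "finite VH" "\<forall>g\<in>VG. \<forall>h\<in>VH. z (Dom g h) \<in> {0, 1}"
  shows "mpoly_eval z (f_star VG kG VH kH) =
    of_nat (card {(g, h). g \<in> VG \<and> h \<in> VH \<and> z (Dom g h) = 1}) - of_nat (kG * kH)"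
proof -
  have "(\<Sum>(g, h)\<in>VG \<times> VH. z (Dom g h)) = (\<Sum>(g, h)\<in>VG \<times> VH. of_bool (z (Dom g h) = 1))"
    using assms(3) by (intro sum.cong refl) (auto, blast)
  also have "\<dots> = of_nat (card {(g, h). g \<in> VG \<and> h \<in> VH \<and> z (Dom g h) = 1})"
  proof -
    have "VG \<times> VH \<inter> {p. z (Dom (fst p) (snd p)) = 1} = {(g, h). g \<in> VG \<and> h \<in> VH \<and> z (Dom g h) = 1}"
      by auto
    then show ?thesis
      using assms(1,2) by (simp add: case_prod_beta)
  qed
  finally show ?thesis
    by (simp add: f_star_def case_prod_beta flip: of_nat_mult)
qed

lemma of_nat_diff_in_nonneg_Reals_iff:
  "(of_nat m - of_nat n :: complex) \<in> \<real>\<^sub>\<ge>\<^sub>0 \<longleftrightarrow> n \<le> m"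
  by (simp add: complex_nonneg_Reals_iff)

text \<open>The number is a root of a monic linear polynomial. This is applied to 0 and 1, the only
  coordinates of the points built from graphs.\<close>

lemma of_real_in_algebraic_closure_in_complex:
  assumes K: "subring K (ring_of_type_algebra :: real ring)" and "x \<in> K"
  shows "of_real x \<in> algebraic_closure_in_complex K"
proof -
  let ?p = "[:- of_real x, 1:] :: complex poly"
  have "Polynomial.coeff ?p i \<in> of_real ` {- x, 1, 0}" for i
    by (auto simp: coeff_pCons split: nat.split)
  moreover have "{- x, 1, 0} \<subseteq> K"
    using K_closed[OF K] \<open>x \<in> K\<close> by blast
  ultimately have "\<forall>i. Polynomial.coeff ?p i \<in> of_real ` K"
    by blast
  then show ?thesis
    unfolding algebraic_closure_in_complex_def by (auto intro!: exI[of _ ?p])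
qed

text \<open>A point encodes two graphs and a dominating set of their product. For fixed graphs the
  least value of \<open>f_star\<close> occurs at a minimum dominating set, so nonnegativity at all
  these points is a bound on the domination number.\<close>

lemma f_star_nonneg_on_variety_iff:
  fixes VG DG :: "'a set" and VH DH :: "'b set"
  assumes K: "subring K (ring_of_type_algebra :: real ring)"
    and G: "finite VG" "DG \<subseteq> VG" "card DG = kG" "0 < kG"
    and H: "finite VH" "DH \<subseteq> VH" "card DH = kH" "0 < kH"
  shows "(\<forall>z\<in>variety K (sos_vars VG VH) (I_sos K VG DG kG VH DH kH).
       mpoly_eval z (f_star VG kG VH kH) \<in> \<real>\<^sub>\<ge>\<^sub>0) \<longleftrightarrow>
    (\<forall>G H. pair_graph G \<longrightarrow> pverts G = VG \<longrightarrow> dominating G DG \<longrightarrow> domination_number G = kG \<longrightarrow>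
      pair_graph H \<longrightarrow> pverts H = VH \<longrightarrow> dominating H DH \<longrightarrow> domination_number H = kH \<longrightarrow>
      kG * kH \<le> domination_number (cartesian_product G H))"
    (is "?L \<longleftrightarrow> ?R")
proof
  assume L: ?L
  show ?R
  proof (intro allI impI)
    fix G H
    assume G': "pair_graph G" "pverts G = VG" "dominating G DG" "domination_number G = kG"
      and H': "pair_graph H" "pverts H = VH" "dominating H DH" "domination_number H = kH"
    obtain A where A: "dominating (cartesian_product G H) A"
        "card A = domination_number (cartesian_product G H)"
      using obtain_minimum_dominating[of "cartesian_product G H"] G(1) H(1) G'(2) H'(2) by auto
    then have "A \<subseteq> VG \<times> VH"
      using G'(2) H'(2) by (simp add: dominating_def)
    define cG :: "'a set \<Rightarrow> complex" where
      "cG = (\<lambda>S. if \<exists>(u, w)\<in>parcs G. S = {u, w} then 1 else 0)"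
    define cH :: "'b set \<Rightarrow> complex" where
      "cH = (\<lambda>S. if \<exists>(u, w)\<in>parcs H. S = {u, w} then 1 else 0)"
    \<comment> \<open>Points of the variety are extensional functions on \<open>sos_vars\<close>,
      hence the restriction.\<close>
    define z where "z = restrict (\<lambda>v. case v of EdgeG S \<Rightarrow> cG S | EdgeH S \<Rightarrow> cH S |
      Dom g h \<Rightarrow> of_bool ((g, h) \<in> A)) (sos_vars VG VH)"
    have zG: "z (EdgeG {u, w}) = cG {u, w}" if "u \<in> VG" "w \<in> VG" "u \<noteq> w" for u w
      using that by (auto simp: z_def sos_vars_def)
    have zH: "z (EdgeH {u, w}) = cH {u, w}" if "u \<in> VH" "w \<in> VH" "u \<noteq> w" for u w
      using that by (auto simp: z_def sos_vars_def)
    have zD: "z (Dom g h) = of_bool ((g, h) \<in> A)" if "g \<in> VG" "h \<in> VH" for g h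
      using that by (auto simp: z_def sos_vars_def)
    \<comment> \<open>Decoding \<open>z\<close> returns \<open>G\<close> and \<open>H\<close>
      themselves, so the vanishing criteria apply to them.\<close>
    have graphs: "value_graph VG (\<lambda>S. z (EdgeG S)) = G" "value_graph VH (\<lambda>S. z (EdgeH S)) = H"
      using value_graph_cong[of VG "\<lambda>S. z (EdgeG S)" cG] zG
        value_graph_indicator[OF G'(1), folded cG_def]
        value_graph_cong[of VH "\<lambda>S. z (EdgeH S)" cH] zH
        value_graph_indicator[OF H'(1), folded cH_def] G'(2) H'(2) by auto
    have bool: "\<forall>u\<in>VG. \<forall>w\<in>VG. u \<noteq> w \<longrightarrow> z (EdgeG {u, w}) \<in> {0, 1}"
        "\<forall>u\<in>VH. \<forall>w\<in>VH. u \<noteq> w \<longrightarrow> z (EdgeH {u, w}) \<in> {0, 1}"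
        "\<forall>g\<in>VG. \<forall>h\<in>VH. z (Dom g h) \<in> {0, 1}"
      using zG zH zD by (auto simp: cG_def cH_def)
    have zA: "{(g, h). g \<in> VG \<and> h \<in> VH \<and> z (Dom g h) = 1} = A"
      using \<open>A \<subseteq> VG \<times> VH\<close> by (auto simp: zD)
    have "z \<in> sos_vars VG VH \<rightarrow>\<^sub>E algebraic_closure_in_complex K"
    proof -
      have "0 \<in> algebraic_closure_in_complex K" "1 \<in> algebraic_closure_in_complex K"
        using of_real_in_algebraic_closure_in_complex[OF K, of 0]
          of_real_in_algebraic_closure_in_complex[OF K, of 1] K_closed(1,2)[OF K] by simp_all
      then show ?thesis
        unfolding z_def by (intro restrict_PiE_iff[THEN iffD2]) (auto simp: cG_def cH_def split: sos_var.split)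
    qed
    moreover have "\<forall>p\<in>graph_gens eG VG DG kG. mpoly_eval z p = 0"
      using G G' bool graphs by (simp add: graph_gens_vanish_iff)
    moreover have "\<forall>p\<in>graph_gens eH VH DH kH. mpoly_eval z p = 0"
      using H H' bool graphs by (simp add: graph_gens_vanish_iff)
    moreover have "\<forall>p\<in>product_gens VG VH. mpoly_eval z p = 0"
      using product_gens_vanish_iff[OF G(1) H(1) bool(1,2)] bool(3) A(1) by (simp add: graphs zA)
    ultimately have "z \<in> variety K (sos_vars VG VH) (I_sos K VG DG kG VH DH kH)"
      using K G H by (simp add: mem_variety_I_sos)
    then have "mpoly_eval z (f_star VG kG VH kH) \<in> \<real>\<^sub>\<ge>\<^sub>0"
      using L by blast
    then show "kG * kH \<le> domination_number (cartesian_product G H)"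
      unfolding mpoly_eval_f_star[OF G(1) H(1) bool(3)] zA of_nat_diff_in_nonneg_Reals_iff A(2) .
  qed
next
  assume R: ?R
  show ?L
  proof
    fix z assume "z \<in> variety K (sos_vars VG VH) (I_sos K VG DG kG VH DH kH)"
    then have gens: "\<forall>p\<in>graph_gens eG VG DG kG. mpoly_eval z p = 0"
        "\<forall>p\<in>graph_gens eH VH DH kH. mpoly_eval z p = 0"
        "\<forall>p\<in>product_gens VG VH. mpoly_eval z p = 0"
      using K G H by (simp_all add: mem_variety_I_sos)
    let ?G = "value_graph VG (\<lambda>S. z (EdgeG S))" and ?H = "value_graph VH (\<lambda>S. z (EdgeH S))"
    let ?X = "{(g, h). g \<in> VG \<and> h \<in> VH \<and> z (Dom g h) = 1}"
    note G' = gens(1)[unfolded graph_gens_vanish_iff[OF G]]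
    note H' = gens(2)[unfolded graph_gens_vanish_iff[OF H]]
    \<comment> \<open>The product generators can be read only after the two graph families have
      forced the edge values to be 0 or 1.\<close>
    note X = gens(3)[unfolded product_gens_vanish_iff[OF G(1) H(1) conjunct1[OF G'] conjunct1[OF H']]]
    have "kG * kH \<le> domination_number (cartesian_product ?G ?H)"
      using R G' H' pair_graph_value_graph[OF G(1)] pair_graph_value_graph[OF H(1)] by simp
    also have "\<dots> \<le> card ?X"
      using X G(1) H(1) by (intro domination_number_le) simp_all
    finally show "mpoly_eval z (f_star VG kG VH kH) \<in> \<real>\<^sub>\<ge>\<^sub>0"
      unfolding mpoly_eval_f_star[OF G(1) H(1) conjunct1[OF X]] of_nat_diff_in_nonneg_Reals_iff .
  qed
qed

section \<open>Independence of the vertex types\<close>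

lemma exists_inj_on_into_infinite:
  assumes "finite A"
  obtains f :: "'a \<Rightarrow> 'b :: infinite" where "inj_on f A"
proof -
  obtain B :: "'b set" where "finite B" "card B = card A"
    using infinite_arbitrarily_large[OF infinite_UNIV] by blast
  with assms that show thesis
    by (metis finite_same_card_bij bij_betw_imp_inj_on)
qed

text \<open>A bijection of the subsets is glued to one of the complements, which have equal finite
  size.\<close>

lemma exists_bij_betw_mapping_subset:
  assumes "finite A" "finite B" "card A = card B" "A' \<subseteq> A" "B' \<subseteq> B" "card A' = card B'"
  obtains f where "bij_betw f A B" "f ` A' = B'"
proof -
  have fin: "finite A'" "finite B'"
    using assms finite_subset by blast+
  obtain g where g: "bij_betw g A' B'"
    using finite_same_card_bij fin assms(6) by blast
  obtain h where h: "bij_betw h (A - A') (B - B')"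
    using finite_same_card_bij[of "A - A'" "B - B'"] assms fin by (auto simp: card_Diff_subset)
  have "bij_betw (\<lambda>x. if x \<in> A' then g x else h x) (A' \<union> (A - A')) (B' \<union> (B - B'))"
    by (rule bij_betw_disjoint_Un[OF g h]) auto
  moreover have "(\<lambda>x. if x \<in> A' then g x else h x) ` A' = B'"
    using g by (simp add: bij_betw_def cong: image_cong_simp)
  ultimately show thesis
    using that assms(4,5) by (metis Un_Diff_cancel Un_absorb1)
qed

text \<open>Finite vertex sets inject into any infinite type, so the inequality on one pair of
  infinite types gives it on every pair of types, finite ones included.\<close>

lemma vizing_change_vertex_type:
  fixes G :: "'a pair_pre_digraph" and H :: "'b pair_pre_digraph"
  assumes vizing: "\<And>(G :: 'c::infinite pair_pre_digraph) (H :: 'd::infinite pair_pre_digraph).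
      pair_graph G \<Longrightarrow> pair_graph H \<Longrightarrow>
      domination_number G * domination_number H \<le> domination_number (cartesian_product G H)"
    and G: "pair_graph G" and H: "pair_graph H"
  shows "domination_number G * domination_number H \<le> domination_number (cartesian_product G H)"
proof -
  obtain f :: "'a \<Rightarrow> 'c" where f: "inj_on f (pverts G)"
    using exists_inj_on_into_infinite G by (auto simp: pair_graph_iff)
  obtain f' :: "'b \<Rightarrow> 'd" where f': "inj_on f' (pverts H)"
    using exists_inj_on_into_infinite H by (auto simp: pair_graph_iff)
  have "domination_number (map_graph f G) * domination_number (map_graph f' H)
      \<le> domination_number (cartesian_product (map_graph f G) (map_graph f' H))"
    using G H f f' by (intro vizing pair_graph_map_graph)
  then show ?thesis
    using G H f f' unfolding domination_number_cartesian_product_map_graph[OF G H f f']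
    by (simp add: domination_number_map_graph pair_graph_iff)
qed

text \<open>Since \<open>D\<close> has the size of a minimum dominating set, the bijection of vertex
  sets can be chosen to carry such a set onto \<open>D\<close>.\<close>

lemma exists_isomorphic_graph_on:
  assumes G: "pair_graph G" and "finite V" "card V = card (pverts G)"
    and "D \<subseteq> V" "card D = domination_number G"
  obtains f where "inj_on f (pverts G)" "pverts (map_graph f G) = V" "dominating (map_graph f G) D"
proof -
  have fin: "finite (pverts G)" and arcs: "parcs G \<subseteq> pverts G \<times> pverts G"
    using G by (simp_all add: pair_graph_iff)
  obtain M where M: "dominating G M" "card M = domination_number G"
    using obtain_minimum_dominating fin by blast
  then have "M \<subseteq> pverts G"
    by (simp add: dominating_def)
  obtain f where f: "bij_betw f (pverts G) V" "f ` M = D"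
    by (rule exists_bij_betw_mapping_subset[of "pverts G" V M D])
      (use assms fin M \<open>M \<subseteq> pverts G\<close> in simp_all)
  then have "inj_on f (pverts G)" "f ` pverts G = V"
    by (simp_all add: bij_betw_def)
  then show thesis
    using M(1) f(2) dominating_map_graph[OF _ arcs, of f M] \<open>M \<subseteq> pverts G\<close>
    by (intro that[of f]) simp_all
qed

theorem theorem3p7:
  fixes K :: "real set"
    and VG DG :: "nat \<Rightarrow> nat \<Rightarrow> 'a set"
    and VH DH :: "nat \<Rightarrow> nat \<Rightarrow> 'b set"
  assumes K: "subfield K (ring_of_type_algebra :: real ring)"
    and G_fixed: "\<And>n k. 0 < k \<Longrightarrow> k \<le> n \<Longrightarrow>
      finite (VG n k) \<and> card (VG n k) = n \<and> DG n k \<subseteq> VG n k \<and> card (DG n k) = k"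
    and H_fixed: "\<And>n k. 0 < k \<Longrightarrow> k \<le> n \<Longrightarrow>
      finite (VH n k) \<and> card (VH n k) = n \<and> DH n k \<subseteq> VH n k \<and> card (DH n k) = k"
  shows "(\<forall>(G :: 'c::infinite pair_pre_digraph) (H :: 'd::infinite pair_pre_digraph).
            pair_graph G \<longrightarrow> pair_graph H \<longrightarrow>
            domination_number G * domination_number H \<le> domination_number (cartesian_product G H))
     \<longleftrightarrow>
         (\<forall>nG kG nH kH. 0 < kG \<longrightarrow> kG \<le> nG \<longrightarrow> 0 < kH \<longrightarrow> kH \<le> nH \<longrightarrow>
            (\<forall>z \<in> variety K (sos_vars (VG nG kG) (VH nH kH))
                    (I_sos K (VG nG kG) (DG nG kG) kG (VH nH kH) (DH nH kH) kH).
               mpoly_eval z (f_star (VG nG kG) kG (VH nH kH) kH) \<in> \<real>\<^sub>\<ge>\<^sub>0))"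
    (is "?vizing \<longleftrightarrow> (\<forall>nG kG nH kH. 0 < kG \<longrightarrow> kG \<le> nG \<longrightarrow> 0 < kH \<longrightarrow> kH \<le> nH \<longrightarrow> ?nonneg nG kG nH kH)")
proof -
  have subring: "subring K (ring_of_type_algebra :: real ring)"
    using K unfolding subfield_def subdomain_def subcring_def by blast
  have nonneg_iff: "?nonneg nG kG nH kH \<longleftrightarrow>
      (\<forall>G H. pair_graph G \<longrightarrow> pverts G = VG nG kG \<longrightarrow> dominating G (DG nG kG) \<longrightarrow>
        domination_number G = kG \<longrightarrow> pair_graph H \<longrightarrow> pverts H = VH nH kH \<longrightarrow>
        dominating H (DH nH kH) \<longrightarrow> domination_number H = kH \<longrightarrow>
        kG * kH \<le> domination_number (cartesian_product G H))"
    if "0 < kG" "kG \<le> nG" "0 < kH" "kH \<le> nH" for nG kG nH kH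
    using G_fixed[OF that(1,2)] H_fixed[OF that(3,4)] that
    by (intro f_star_nonneg_on_variety_iff[OF subring]) simp_all
  show ?thesis
  proof (intro iffI allI impI)
    fix nG kG nH kH :: nat
    assume vizing: ?vizing and k: "0 < kG" "kG \<le> nG" "0 < kH" "kH \<le> nH"
    show "?nonneg nG kG nH kH"
      unfolding nonneg_iff[OF k]
      \<comment> \<open>The graphs here lie on the fixed vertex sets, hence on \<open>'a\<close> and
        \<open>'b\<close>, while \<open>vizing\<close> speaks of \<open>'c\<close> and
        \<open>'d\<close>.\<close>
      using vizing_change_vertex_type[where 'c = 'c and 'd = 'd, OF vizing[rule_format]] by metis
  next
    fix G :: "'c pair_pre_digraph" and H :: "'d pair_pre_digraph"
    assume nonneg: "\<forall>nG kG nH kH. 0 < kG \<longrightarrow> kG \<le> nG \<longrightarrow> 0 < kH \<longrightarrow> kH \<le> nH \<longrightarrow> ?nonneg nG kG nH kH"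
      and G: "pair_graph G" and H: "pair_graph H"
    define nG kG nH kH where "nG = card (pverts G)" "kG = domination_number G"
      "nH = card (pverts H)" "kH = domination_number H"
    note defs = this
    have fin: "finite (pverts G)" "finite (pverts H)"
      and arcs: "parcs G \<subseteq> pverts G \<times> pverts G" "parcs H \<subseteq> pverts H \<times> pverts H"
      using G H by (simp_all add: pair_graph_iff)
    show "domination_number G * domination_number H \<le> domination_number (cartesian_product G H)"
    proof (cases "kG = 0 \<or> kH = 0")
      \<comment> \<open>This case lies outside the parameter range of (ii), but the left-hand side
        is 0.\<close>
      case True
      then show ?thesis
        by (auto simp: defs)
    next
      case False
      \<comment> \<open>\<open>kG \<le> nG\<close> and \<open>kH \<le> nH\<close> hold because the
        full vertex set dominates.\<close>
      then have k: "0 < kG" "kG \<le> nG" "0 < kH" "kH \<le> nH"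
        using fin by (simp_all add: defs domination_number_le_card)
      obtain f where f: "inj_on f (pverts G)" "pverts (map_graph f G) = VG nG kG"
          "dominating (map_graph f G) (DG nG kG)"
        by (rule exists_isomorphic_graph_on[OF G, of "VG nG kG" "DG nG kG"])
          (use G_fixed[OF k(1,2)] in \<open>simp_all add: defs\<close>)
      obtain f' where f': "inj_on f' (pverts H)" "pverts (map_graph f' H) = VH nH kH"
          "dominating (map_graph f' H) (DH nH kH)"
        by (rule exists_isomorphic_graph_on[OF H, of "VH nH kH" "DH nH kH"])
          (use H_fixed[OF k(3,4)] in \<open>simp_all add: defs\<close>)
      have "?nonneg nG kG nH kH"
        using nonneg k by blast
      \<comment> \<open>Relabelling preserves domination numbers, so the copies meet the conditions
        for the fixed sets with the parameters of \<open>G\<close> and \<open>H\<close>.\<close>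
      then have "kG * kH \<le> domination_number (cartesian_product (map_graph f G) (map_graph f' H))"
        unfolding nonneg_iff[OF k]
        using f f' pair_graph_map_graph[OF G f(1)] pair_graph_map_graph[OF H f'(1)]
        by (simp add: domination_number_map_graph arcs defs)
      then show ?thesis
        by (simp add: domination_number_cartesian_product_map_graph[OF G H f(1) f'(1)] defs)
    qed
  qed
qed

end
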